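(* Let $1\le k<n$ be integers with $n>T(k)$. Then $m(1,J(n,k))\ge N(n,k)+1$.
   Context: $J(n,k)$ is the Johnson graph on the $k$-subsets of $\{1,\dots,n\}$ (adjacent iff they meet in $k-1$ elements); $\theta_1(J(n,k))=(k-1)(n-k-1)-1$ is its second largest eigenvalue. NZI means all entries nonzero integers; $m(1,J(n,k))=\min\{\|v\|_\infty+1: v\text{ an NZI }\theta_1(J(n,k))\text{-eigenvector}\}$. $(x,y)$ denotes $\gcd(x,y)$. Let $\gamma$ be the smallest positive integer not dividing $k$, and set $j=2k$ if $k$ is odd and $j=(\lfloor\gamma/2\rfloor+1)(2k+\gamma)$ if $k$ is even; $T(k)=j^2+2kj+3k-j-\frac{j^2}{k}$. $B(n,k)$ is the set of quadruples $(a,b,r,s)$ of non-negative integers with $b\ne0$, $0\le r<s$, $(s,r)=1$, $s$ dividing $(n,k)$, and $\frac{(bs-r)k}{s(a+b)}$ not an integer. $N(n,k)=\min\{\max\{k(a+\frac rs),\,k(b-\frac rs)\}:(a,b,r,s)\in B(n,k)\}$. *)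

theory Defs
  imports Complex_Main "Graph_Theory.Graph_Theory"
begin

text \<open>Adjacency eigenvectors of a graph \<open>G\<close> are represented as real functions on the vertex
  type; only their values on the vertex set matter, and an undirected edge is a pair of opposite
  arcs.\<close>

definition graph_eigenvector :: "'v pair_pre_digraph \<Rightarrow> real \<Rightarrow> ('v \<Rightarrow> real) \<Rightarrow> bool" where
  "graph_eigenvector G \<theta> v \<longleftrightarrow>
     (\<exists>u\<in>pverts G. v u \<noteq> 0) \<and>
     (\<forall>u\<in>pverts G. (\<Sum>w \<in> {w \<in> pverts G. u \<rightarrow>\<^bsub>G\<^esub> w}. v w) = \<theta> * v u)"

definition graph_eigenvalues :: "'v pair_pre_digraph \<Rightarrow> real set" where
  "graph_eigenvalues G = {\<theta>. \<exists>v. graph_eigenvector G \<theta> v}"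

text \<open>The second largest among the distinct eigenvalues. For a connected graph the largest one is
  simple, so counting with multiplicity gives the same value.\<close>

definition theta1 :: "'v pair_pre_digraph \<Rightarrow> real" where
  "theta1 G = Max (graph_eigenvalues G - {Max (graph_eigenvalues G)})"

definition NZI :: "'v pair_pre_digraph \<Rightarrow> ('v \<Rightarrow> real) \<Rightarrow> bool" where
  "NZI G v \<longleftrightarrow> (\<forall>u\<in>pverts G. v u \<in> \<int> \<and> v u \<noteq> 0)"

definition inf_norm :: "'v pair_pre_digraph \<Rightarrow> ('v \<Rightarrow> real) \<Rightarrow> real" where
  "inf_norm G v = Max ((\<lambda>u. \<bar>v u\<bar>) ` pverts G)"

text \<open>On a finite nonempty graph the norms of NZI vectors are positive integers, so the infimum
  below is attained (as soon as there is an NZI eigenvector) and is a minimum.\<close>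

definition m1 :: "'v pair_pre_digraph \<Rightarrow> real" where
  "m1 G = Inf {inf_norm G v + 1 | v. graph_eigenvector G (theta1 G) v \<and> NZI G v}"

text \<open>Writing \<open>card (S \<inter> T) + 1 = k\<close> instead of \<open>card (S \<inter> T) = k - 1\<close> avoids truncated
  subtraction; it also excludes loops.\<close>

definition johnson :: "nat \<Rightarrow> nat \<Rightarrow> nat set pair_pre_digraph" where
  "johnson n k =
     (let V = {S. S \<subseteq> {1..n} \<and> card S = k}
      in \<lparr> pverts = V, parcs = {(S, T). S \<in> V \<and> T \<in> V \<and> card (S \<inter> T) + 1 = k} \<rparr>)"

definition gamma :: "nat \<Rightarrow> nat" where
  "gamma k = (LEAST g. 0 < g \<and> \<not> g dvd k)"

definition jpar :: "nat \<Rightarrow> nat" where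
  "jpar k = (if odd k then 2 * k else (gamma k div 2 + 1) * (2 * k + gamma k))"

definition T :: "nat \<Rightarrow> real" where
  "T k = (let j = real (jpar k) in j\<^sup>2 + 2 * k * j + 3 * k - j - j\<^sup>2 / k)"

definition B :: "nat \<Rightarrow> nat \<Rightarrow> (nat \<times> nat \<times> nat \<times> nat) set" where
  "B n k = {(a, b, r, s). b \<noteq> 0 \<and> r < s \<and> coprime s r \<and> s dvd gcd n k \<and>
     (real b * real s - real r) * real k / (real s * (real a + real b)) \<notin> \<int>}"

text \<open>Since \<open>s\<close> divides \<open>k\<close>, the values below are integers, and they are nonnegative
  because \<open>b \<ge> 1 > r / s\<close>; so this infimum is a minimum as well.\<close>

definition N :: "nat \<Rightarrow> nat \<Rightarrow> real" where
  "N n k = Inf {max (real k * (real a + real r / real s)) (real k * (real b - real r / real s))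
                | a b r s. (a, b, r, s) \<in> B n k}"

end

theory Submission
  imports Defs
begin

text \<open>Restricting functions from \<open>k\<close>-sets to \<open>(k - 1)\<close>-sets (\<open>down\<close>) intertwines the adjacency
  operators up to a shift, which gives all eigenvalues by induction on \<open>k\<close> and shows that the
  eigenvectors of the second one, \<open>k (n - k) - n = (k - 1) (n - k - 1) - 1\<close>, are the functions
  \<open>S \<mapsto> \<Sum>i\<in>S. x i\<close> with \<open>\<Sum>i. x i = 0\<close>. For a nowhere zero integral one, the entries of \<open>x\<close>
  share a fractional part \<open>r / s\<close>. If a positive entry \<open>a + r / s\<close> and a negative entry
  \<open>r / s - b\<close> both occur at least \<open>k\<close> times, then the \<open>k\<close>-sets made of these two entries show that
  \<open>(a, b, r, s)\<close> lies in \<open>B n k\<close> and that the norm is at least its value. Otherwise \<open>x\<close>, or its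
  negative, has only rare nonpositive entries; when the norm is below \<open>N n k \<le> jpar k / 2\<close>, this
  forces \<open>n \<le> T k\<close>.\<close>

text \<open>Otherwise \<open>{1..n}\<close> is rewritten to \<open>{Suc 0..n}\<close> and facts about it no longer match.\<close>
declare One_nat_def [simp del]

section \<open>The eigenspace of the second largest eigenvalue\<close>

lemma johnson_verts: "S \<in> pverts (johnson n k) \<longleftrightarrow> S \<subseteq> {1..n} \<and> card S = k"
  by (simp add: johnson_def Let_def)

lemma finite_johnson_verts: "finite (pverts (johnson n k))"
  by (rule finite_subset[of _ "Pow {1..n}"]) (use johnson_verts in blast, simp)

text \<open>Neighbours of \<open>S\<close> are indexed by the element \<open>i\<close> removed and
  the element \<open>j\<close> added. No size parameter occurs, so one operator serves all levels of
  the induction.\<close>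

definition adj :: "nat \<Rightarrow> (nat set \<Rightarrow> real) \<Rightarrow> nat set \<Rightarrow> real" where
  "adj n f S = (\<Sum>i\<in>S. \<Sum>j\<in>{1..n} - S. f (insert j (S - {i})))"

text \<open>Multiplication by the inclusion matrix between consecutive set sizes.\<close>

definition down :: "nat \<Rightarrow> (nat set \<Rightarrow> real) \<Rightarrow> nat set \<Rightarrow> real" where
  "down n f R = (\<Sum>j\<in>{1..n} - R. f (insert j R))"

lemma johnson_nbrs_sum:
  assumes S: "S \<subseteq> {1..n}" "card S = k"
  shows "(\<Sum>w\<in>{w \<in> pverts (johnson n k). S \<rightarrow>\<^bsub>johnson n k\<^esub> w}. f w) = adj n f S"
proof -
  have fS: "finite S" using S finite_subset by blast
  have nb: "{w \<in> pverts (johnson n k). S \<rightarrow>\<^bsub>johnson n k\<^esub> w}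
      = {W. W \<subseteq> {1..n} \<and> card W = k \<and> card (S \<inter> W) + 1 = k}"
    using S by (auto simp: johnson_def Let_def)
  have inj: "inj_on (\<lambda>(i, j). insert j (S - {i})) (S \<times> ({1..n} - S))"
  proof (rule inj_onI, clarify)
    fix i j i' j'
    assume ij: "i \<in> S" "j \<notin> S" "i' \<in> S" "j' \<notin> S" and e: "insert j (S - {i}) = insert j' (S - {i'})"
    have "j = j'" using e ij by blast
    moreover have "{i} = S - insert j (S - {i})" using ij by auto
    moreover have "S - insert j' (S - {i'}) = {i'}" using ij by auto
    ultimately show "i = i' \<and> j = j'" unfolding e by simp
  qed
  have img: "(\<lambda>(i, j). insert j (S - {i})) ` (S \<times> ({1..n} - S))
      = {W. W \<subseteq> {1..n} \<and> card W = k \<and> card (S \<inter> W) + 1 = k}" (is "?L = ?R")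
  proof (intro equalityI subsetI)
    fix W assume "W \<in> ?L"
    then obtain i j where ij: "i \<in> S" "j \<in> {1..n}" "j \<notin> S" "W = insert j (S - {i})" by auto
    have "S \<inter> W = S - {i}" using ij by auto
    moreover have "card (S - {i}) + 1 = k" using ij fS S card_Suc_Diff1 by fastforce
    ultimately show "W \<in> ?R" using ij fS S by auto
  next
    fix W assume W: "W \<in> ?R"
    have fW: "finite W" using W finite_subset[of W "{1..n}"] by auto
    have "card (S - W) = 1"
      using card_Int_Diff[OF fS, of W] W S by simp
    then obtain i where i: "S - W = {i}" by (rule card_1_singletonE)
    have "card (W - S) = 1"
      using card_Int_Diff[OF fW, of S] W S by (simp add: Int_commute)
    then obtain j where j: "W - S = {j}" by (rule card_1_singletonE)
    have "W = insert j (S - {i})" "i \<in> S" "j \<in> {1..n} - S" using i j W by auto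
    then show "W \<in> ?L" by force
  qed
  have "adj n f S = sum (f \<circ> (\<lambda>(i, j). insert j (S - {i}))) (S \<times> ({1..n} - S))"
    unfolding adj_def by (simp add: sum.cartesian_product case_prod_unfold comp_def)
  also have "\<dots> = sum f ((\<lambda>(i, j). insert j (S - {i})) ` (S \<times> ({1..n} - S)))"
    by (rule sum.reindex[OF inj, symmetric])
  finally show ?thesis unfolding nb img by simp
qed

lemma graph_eigenvector_johnson:
  "graph_eigenvector (johnson n k) \<theta> v \<longleftrightarrow>
     (\<exists>S. S \<subseteq> {1..n} \<and> card S = k \<and> v S \<noteq> 0) \<and>
     (\<forall>S. S \<subseteq> {1..n} \<longrightarrow> card S = k \<longrightarrow> adj n v S = \<theta> * v S)"
proof -
  have "(\<forall>u\<in>pverts (johnson n k).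
      (\<Sum>w\<in>{w \<in> pverts (johnson n k). u \<rightarrow>\<^bsub>johnson n k\<^esub> w}. v w) = \<theta> * v u) \<longleftrightarrow>
    (\<forall>u\<in>pverts (johnson n k). adj n v u = \<theta> * v u)"
    by (intro ball_cong refl) (auto simp only: johnson_verts johnson_nbrs_sum[unfolded johnson_verts])
  then show ?thesis unfolding graph_eigenvector_def Ball_def Bex_def johnson_verts
    by (simp only: imp_conjL conj_assoc)
qed

text \<open>Removing \<open>i\<close> and then adding an element either restores \<open>S\<close>,
  once for each \<open>i\<close>, or performs a swap.\<close>

lemma adj_eq_down:
  assumes S: "S \<subseteq> {1..n}"
  shows "adj n f S = (\<Sum>i\<in>S. down n f (S - {i})) - real (card S) * f S"
proof -
  have "down n f (S - {i}) = f S + (\<Sum>j\<in>{1..n} - S. f (insert j (S - {i})))" if i: "i \<in> S" for i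
  proof -
    have "{1..n} - (S - {i}) = insert i ({1..n} - S)" using i S by auto
    then show ?thesis using i unfolding down_def by (simp add: insert_absorb)
  qed
  then have "(\<Sum>i\<in>S. down n f (S - {i})) = (\<Sum>i\<in>S. f S) + adj n f S"
    unfolding adj_def by (simp add: sum.distrib)
  then show ?thesis by simp
qed

text \<open>Expand \<open>adj n f (insert j R)\<close> by \<open>adj_eq_down\<close>: removing
  \<open>j\<close> itself gives \<open>down n f R\<close>, for n - |R| choices of \<open>j\<close>,
  and removing an element of \<open>R\<close> gives a swap for \<open>down n f\<close>. The
  correction by |R| + 1 copies of \<open>f (insert j R)\<close> completes the shift.\<close>

lemma down_adj:
  assumes R: "R \<subseteq> {1..n}"
  shows "down n (adj n f) R = adj n (down n f) R + (real n - 2 * real (card R) - 1) * down n f R"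
proof -
  have fR: "finite R" using R finite_subset by blast
  have *: "adj n f (insert j R) = down n f R + (\<Sum>i\<in>R. down n f (insert j (R - {i})))
     - (real (card R) + 1) * f (insert j R)" if j: "j \<in> {1..n} - R" for j
  proof -
    have "(\<Sum>i\<in>R. down n f (insert j R - {i})) = (\<Sum>i\<in>R. down n f (insert j (R - {i})))"
      using j by (intro sum.cong) (auto simp: insert_Diff_if)
    then show ?thesis
      using adj_eq_down[of "insert j R" n f] j R fR by simp
  qed
  have c: "real (card ({1..n} - R)) = real n - real (card R)"
    using R fR card_mono[OF _ R] by (simp add: card_Diff_subset of_nat_diff)
  have "down n (adj n f) R = (\<Sum>j\<in>{1..n} - R. down n f R)
      + (\<Sum>j\<in>{1..n} - R. \<Sum>i\<in>R. down n f (insert j (R - {i})))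
      - (real (card R) + 1) * down n f R"
    unfolding down_def[of n "adj n f" R] down_def[of n f R]
    using * by (simp add: sum.distrib sum_subtractf sum_distrib_left down_def)
  also have "(\<Sum>j\<in>{1..n} - R. \<Sum>i\<in>R. down n f (insert j (R - {i}))) = adj n (down n f) R"
    unfolding adj_def by (rule sum.swap)
  finally show ?thesis by (simp only: sum_constant c) (simp add: algebra_simps)
qed

lemma down_eigen:
  assumes ev: "\<And>S. S \<subseteq> {1..n} \<Longrightarrow> card S = Suc k \<Longrightarrow> adj n f S = \<theta> * f S"
    and R: "R \<subseteq> {1..n}" "card R = k"
  shows "adj n (down n f) R = (\<theta> - (real n - 2 * real k - 1)) * down n f R"
proof -
  have fR: "finite R" using R finite_subset by blast
  have "down n (adj n f) R = \<theta> * down n f R"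
    unfolding down_def sum_distrib_left
    using R fR by (intro sum.cong refl ev) auto
  then show ?thesis using down_adj[OF R(1), of f] R(2) by (simp add: algebra_simps)
qed

text \<open>This recovers \<open>f\<close> from \<open>down n f\<close> unless \<theta> =
  -k.\<close>

lemma eigen_eq_sum_down:
  assumes ev: "\<And>S. S \<subseteq> {1..n} \<Longrightarrow> card S = k \<Longrightarrow> adj n f S = \<theta> * f S"
    and S: "S \<subseteq> {1..n}" "card S = k"
  shows "(\<theta> + real k) * f S = (\<Sum>i\<in>S. down n f (S - {i}))"
  using adj_eq_down[OF S(1), of f] ev[OF S] S by (simp add: algebra_simps)

text \<open>If \<open>down n v\<close> vanishes on all \<open>k\<close>-sets, the recovery formula
  forces the first alternative.\<close>

lemma graph_eigenvector_down:
  assumes "graph_eigenvector (johnson n (Suc k)) \<theta> v"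
  shows "\<theta> = - real (Suc k) \<or>
    graph_eigenvector (johnson n k) (\<theta> - (real n - 2 * real k - 1)) (down n v)"
proof (cases "\<exists>R. R \<subseteq> {1..n} \<and> card R = k \<and> down n v R \<noteq> 0")
  case True
  then show ?thesis using assms down_eigen[of n k v \<theta>] unfolding graph_eigenvector_johnson by blast
next
  case False
  from assms obtain S where S: "S \<subseteq> {1..n}" "card S = Suc k" "v S \<noteq> 0"
    unfolding graph_eigenvector_johnson by blast
  have fS: "finite S" using S finite_subset by blast
  have "(\<theta> + real (Suc k)) * v S = (\<Sum>i\<in>S. down n v (S - {i}))"
    using assms S by (intro eigen_eq_sum_down) (auto simp: graph_eigenvector_johnson)
  also have "\<dots> = 0"
    proof (intro sum.neutral ballI)
    fix i assume "i \<in> S"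
    then have "S - {i} \<subseteq> {1..n}" "card (S - {i}) = k" using S fS by auto
    then show "down n v (S - {i}) = 0" using False by blast
  qed
  finally show ?thesis using S by auto
qed

section \<open>The spectrum and the second eigenspace\<close>

lemma graph_eigenvector_0:
  assumes "graph_eigenvector (johnson n 0) \<theta> v"
  shows "\<theta> = 0"
proof -
  obtain S where S: "S \<subseteq> {1..n}" "card S = 0" "v S \<noteq> 0"
    using assms unfolding graph_eigenvector_johnson by blast
  then have "S = {}" using finite_subset by fastforce
  moreover have "adj n v S = \<theta> * v S" using assms S unfolding graph_eigenvector_johnson by blast
  ultimately show ?thesis using S by (simp add: adj_def)
qed

text \<open>Each level shifts the previous eigenvalues and adds at most one new one. Finiteness
  makes the \<open>Max\<close> in \<open>theta1\<close> meaningful.\<close>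

lemma finite_johnson_eigenvalues: "finite (graph_eigenvalues (johnson n k))"
proof (induction k)
  case 0
  have "graph_eigenvalues (johnson n 0) \<subseteq> {0}"
    using graph_eigenvector_0 by (auto simp: graph_eigenvalues_def)
  then show ?case using finite_subset by blast
next
  case (Suc k)
  have "graph_eigenvalues (johnson n (Suc k)) \<subseteq> insert (- real (Suc k))
     ((\<lambda>t. t + (real n - 2 * real k - 1)) ` graph_eigenvalues (johnson n k))" (is "_ \<subseteq> insert _ (?h ` _)")
  proof
    fix t assume "t \<in> graph_eigenvalues (johnson n (Suc k))"
    then obtain v where "graph_eigenvector (johnson n (Suc k)) t v" by (auto simp: graph_eigenvalues_def)
    from graph_eigenvector_down[OF this]
    show "t \<in> insert (- real (Suc k)) (?h ` graph_eigenvalues (johnson n k))"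
      by (force simp: graph_eigenvalues_def intro: image_eqI[where x = "t - (real n - 2 * real k - 1)"])
  qed
  then show ?case using Suc finite_subset by blast
qed

text \<open>The shift n - 2k - 1 carries k(n - k) to (k + 1)(n - k - 1), so both alternatives pass
  to the next level. The possible new eigenvalue -(k + 1) falls under the second one because k(n - k
  - 1) >= 0.\<close>

lemma johnson_eigenvalue_gap:
  assumes "graph_eigenvector (johnson n k) \<theta> v" "k < n"
  shows "\<theta> = real k * (real n - real k) \<or> \<theta> \<le> real k * (real n - real k) - real n"
  using assms
proof (induction k arbitrary: \<theta> v)
  case 0
  then show ?case using graph_eigenvector_0 by simp
next
  case (Suc k)
  from graph_eigenvector_down[OF Suc.prems(1)] show ?case
  proof
    assume t: "\<theta> = - real (Suc k)"
    have "real k * (real n - real k - 1) \<ge> 0" using Suc.prems by simp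
    then show ?thesis using t by (simp add: algebra_simps)
  next
    assume "graph_eigenvector (johnson n k) (\<theta> - (real n - 2 * real k - 1)) (down n v)"
    from Suc.IH[OF this] show ?thesis using Suc.prems by (auto simp: algebra_simps)
  qed
qed

text \<open>The second eigenvalue is also carried to the second eigenvalue by the shift, so
  \<open>down n f\<close> has the required form by induction, and the recovery formula passes it on
  to \<open>f\<close>. For k = 1 the eigenvalue is -1, which makes the total zero.\<close>

lemma second_eigenvector_form:
  assumes "1 \<le> k" "k < n"
    and "\<And>S. S \<subseteq> {1..n} \<Longrightarrow> card S = k \<Longrightarrow> adj n f S = (real k * (real n - real k) - real n) * f S"
  shows "\<exists>x. (\<Sum>i=1..n. x i) = 0 \<and> (\<forall>S. S \<subseteq> {1..n} \<longrightarrow> card S = k \<longrightarrow> f S = (\<Sum>i\<in>S. x i))"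
  using assms
proof (induction k arbitrary: f rule: nat_induct_at_least)
  case base
  have sum0: "(\<Sum>i=1..n. f {i}) = 0"
  proof -
    have "adj n f {1} = (\<Sum>j\<in>{1..n} - {1}. f {j})" by (simp add: adj_def)
    moreover have "adj n f {1} = - f {1}" using base by simp
    moreover have "(\<Sum>i=1..n. f {i}) = f {1} + (\<Sum>j\<in>{1..n} - {1}. f {j})"
      using base by (intro sum.remove) auto
    ultimately show ?thesis by simp
  qed
  then show ?case
    by (intro exI[of _ "\<lambda>i. f {i}"]) (fastforce simp: card_1_singleton_iff[unfolded One_nat_def[symmetric]])
next
  case (Suc k)
  let ?t = "real (Suc k) * (real n - real (Suc k)) - real n"
  have t: "?t - (real n - 2 * real k - 1) = real k * (real n - real k) - real n"
    by (simp add: algebra_simps)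
  have "adj n (down n f) R = (real k * (real n - real k) - real n) * down n f R"
    if "R \<subseteq> {1..n}" "card R = k" for R
    using down_eigen[of n k f ?t R] Suc.prems(2) that unfolding t by blast
  from Suc.IH[OF Suc_lessD[OF Suc.prems(1)] this] obtain y where y: "(\<Sum>i=1..n. y i) = 0"
    "\<And>R. R \<subseteq> {1..n} \<Longrightarrow> card R = k \<Longrightarrow> down n f R = (\<Sum>i\<in>R. y i)" by blast
  have pos: "real k * (real n - real k - 1) > 0" using Suc.hyps Suc.prems(1) by simp
  \<comment> \<open>Each element of \<open>S\<close> lies in \<open>k\<close> of the sets
    \<open>S - {i}\<close>, whence the numerator; the denominator is the factor \<theta> + k + 1 of
    the recovery formula.\<close>
  let ?c = "real k / (real k * (real n - real k - 1))"
  have "f S = (\<Sum>i\<in>S. ?c * y i)" if S: "S \<subseteq> {1..n}" "card S = Suc k" for S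
  proof -
    have fS: "finite S" using S finite_subset by blast
    have "(?t + real (Suc k)) * f S = (\<Sum>i\<in>S. down n f (S - {i}))"
      by (rule eigen_eq_sum_down[OF Suc.prems(2) S])
    also have "\<dots> = (\<Sum>i\<in>S. \<Sum>l\<in>S - {i}. y l)"
      using S fS by (intro sum.cong refl y(2)) auto
    also have "\<dots> = (\<Sum>i\<in>S. (\<Sum>l\<in>S. y l) - y i)"
      using fS by (intro sum.cong refl) (simp add: sum_diff1)
    also have "\<dots> = real k * (\<Sum>l\<in>S. y l)"
      using S by (simp add: sum_subtractf algebra_simps)
    also have "?t + real (Suc k) = real k * (real n - real k - 1)" by (simp add: algebra_simps)
    finally have "f S = ?c * (\<Sum>l\<in>S. y l)" using pos
      by (simp add: field_simps)
    then show ?thesis by (simp only: sum_distrib_left)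
  qed
  moreover have "(\<Sum>i=1..n. ?c * y i) = 0" unfolding sum_distrib_left[symmetric] y(1) by simp
  ultimately show ?case by (intro exI[of _ "\<lambda>i. ?c * y i"]) blast
qed

text \<open>A swap changes the sum by x j - x i, and since the total is zero the complement of
  \<open>S\<close> sums to the negative of the sum over \<open>S\<close>.\<close>

lemma adj_sum_form:
  assumes x: "(\<Sum>i=1..n. x i) = 0" and S: "S \<subseteq> {1..n}" "card S = k"
  shows "adj n (\<lambda>S. \<Sum>i\<in>S. x i) S = (real k * (real n - real k) - real n) * (\<Sum>i\<in>S. x i)"
proof -
  have fS: "finite S" using S finite_subset by blast
  have c: "real (card ({1..n} - S)) = real n - real k"
    using S fS card_mono[OF _ S(1)] by (simp add: card_Diff_subset of_nat_diff)
  have o: "(\<Sum>j\<in>{1..n} - S. x j) = - (\<Sum>i\<in>S. x i)"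
    using x sum.subset_diff[OF S(1), of x] by simp
  have "adj n (\<lambda>S. \<Sum>i\<in>S. x i) S = (\<Sum>i\<in>S. \<Sum>j\<in>{1..n} - S. x j + ((\<Sum>i\<in>S. x i) - x i))"
    unfolding adj_def using fS by (intro sum.cong refl) (auto simp: sum_diff1)
  also have "\<dots> = (\<Sum>i\<in>S. - (\<Sum>i\<in>S. x i) + (real n - real k) * ((\<Sum>i\<in>S. x i) - x i))"
    by (simp only: sum.distrib o sum_constant c)
  also have "\<dots> = (real k * (real n - real k) - real n) * (\<Sum>i\<in>S. x i)"
    using S by (simp add: sum.distrib sum_negf sum_subtractf sum_distrib_left[symmetric] algebra_simps)
  finally show ?thesis .
qed

text \<open>This vector is nowhere zero, so it shows both that the second eigenvalue occurs and that the
  infimum defining \<open>m1\<close> is not over the empty set.\<close>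

lemma spike_eigenvector:
  assumes "1 \<le> k" "k < n"
  defines "v \<equiv> \<lambda>S. \<Sum>i\<in>S. if i = n then 1 - real n else 1"
  shows "graph_eigenvector (johnson n k) (real k * (real n - real k) - real n) v" "NZI (johnson n k) v"
proof -
  have s: "(\<Sum>i=1..n. if i = n then 1 - real n else 1) = 0"
  proof -
    have "(\<Sum>i=1..n. if i = n then 1 - real n else 1) = (\<Sum>i=1..n. 1 - (if i = n then real n else 0))"
      by (intro sum.cong) auto
    then show ?thesis using assms by (simp add: sum_subtractf)
  qed
  have v: "v S = (if n \<in> S then real k - real n else real k)" if "S \<subseteq> {1..n}" "card S = k" for S
  proof -
    have fS: "finite S" using that finite_subset by blast
    have "v S = (\<Sum>i\<in>S. 1 - (if i = n then real n else 0))"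
      unfolding v_def by (intro sum.cong) auto
    then show ?thesis using that fS by (simp add: sum_subtractf)
  qed
  show "NZI (johnson n k) v"
    using assms(1,2) unfolding NZI_def by (auto simp: johnson_verts v)
  have "{1..k} \<subseteq> {1..n}" "card {1..k} = k" using assms by auto
  moreover from this have "v {1..k} \<noteq> 0" using v[of "{1..k}"] assms by simp
  moreover have "adj n v S = (real k * (real n - real k) - real n) * v S"
    if "S \<subseteq> {1..n}" "card S = k" for S
    unfolding v_def by (rule adj_sum_form[OF s that])
  ultimately show "graph_eigenvector (johnson n k) (real k * (real n - real k) - real n) v"
    unfolding graph_eigenvector_johnson by (intro conjI exI[of _ "{1..k}"]) auto
qed

text \<open>Constants attain the valency k(n - k), the spike vector attains k(n - k) - n, and the
  gap excludes anything between or above.\<close>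

lemma theta1_johnson:
  assumes "1 \<le> k" "k < n"
  shows "theta1 (johnson n k) = real k * (real n - real k) - real n"
proof -
  let ?E = "graph_eigenvalues (johnson n k)"
  let ?t0 = "real k * (real n - real k)"
  have k: "{1..k} \<subseteq> {1..n}" "card {1..k} = k" using assms by auto
  have "adj n (\<lambda>_. 1) S = ?t0 * 1" if S: "S \<subseteq> {1..n}" "card S = k" for S
  proof -
    have fS: "finite S" using S finite_subset by blast
    show ?thesis using S fS card_mono[OF _ S(1)]
      by (simp add: adj_def card_Diff_subset of_nat_diff)
  qed
  then have "graph_eigenvector (johnson n k) ?t0 (\<lambda>_. 1)"
    unfolding graph_eigenvector_johnson using k by (intro conjI exI[of _ "{1..k}"]) simp_all
  then have t0: "?t0 \<in> ?E" by (auto simp: graph_eigenvalues_def)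
  have t1: "?t0 - real n \<in> ?E" using spike_eigenvector(1)[OF assms] by (auto simp: graph_eigenvalues_def)
  have gap: "t = ?t0 \<or> t \<le> ?t0 - real n" if "t \<in> ?E" for t
    using that johnson_eigenvalue_gap[OF _ assms(2)] by (auto simp: graph_eigenvalues_def)
  have "Max ?E = ?t0"
    using gap t0 finite_johnson_eigenvalues by (intro Max_eqI) force+
  moreover have "Max (?E - {?t0}) = ?t0 - real n"
    using gap t1 finite_johnson_eigenvalues assms by (intro Max_eqI) force+
  ultimately show ?thesis unfolding theta1_def by simp
qed

section \<open>Vectors with rare nonpositive entries\<close>

text \<open>Let \<open>A\<close> be a \<open>k\<close>-set of smallest entries. All entries outside \<open>A\<close> are at least \<open>-M/k\<close>, and
  since entries differ by integers the nonpositive ones among them take few values, each of them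
  fewer than \<open>k\<close> times. The remaining entries are at least \<open>1/k\<close>, so there cannot be many of them.\<close>

lemma few_entries_if_nonpos_rare:
  fixes x :: "nat \<Rightarrow> real"
  assumes k: "1 \<le> k" "k \<le> n"
    and sum0: "(\<Sum>i=1..n. x i) = 0"
    and diff: "\<And>i j. i \<in> {1..n} \<Longrightarrow> j \<in> {1..n} \<Longrightarrow> x i - x j \<in> \<int>"
    and kx: "\<And>i. i \<in> {1..n} \<Longrightarrow> real k * x i \<in> \<int>"
    and M: "\<And>S. S \<subseteq> {1..n} \<Longrightarrow> card S = k \<Longrightarrow> - M \<le> (\<Sum>i\<in>S. x i)" "0 \<le> M"
    and rare: "\<And>c. c \<le> 0 \<Longrightarrow> card {i \<in> {1..n}. x i = c} < k"
  shows "real n \<le> k + k * M + (M + 1) * ((real k - 1) * (M / k + 1))"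
proof -
  let ?F = "{S. S \<subseteq> {1..n} \<and> card S = k}"
  have "finite ?F" by (rule finite_subset[of _ "Pow {1..n}"]) auto
  moreover have "{1..k} \<in> ?F" using k by auto
  ultimately obtain A where A: "A \<in> ?F" "\<And>S. S \<in> ?F \<Longrightarrow> (\<Sum>i\<in>A. x i) \<le> (\<Sum>i\<in>S. x i)"
    using ex_is_arg_min_if_finite[of ?F "\<lambda>S. \<Sum>i\<in>S. x i"] unfolding is_arg_min_linorder
    by (metis (no_types, lifting) emptyE)
  then have AS: "A \<subseteq> {1..n}" "card A = k" by auto
  have fA: "finite A" using AS finite_subset by blast
  \<comment> \<open>Otherwise exchanging \<open>a\<close> for \<open>i\<close> would lower the
    minimal sum over \<open>A\<close>.\<close>
  have out: "x a \<le> x i" if "i \<in> {1..n} - A" "a \<in> A" for i a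
  proof -
    have "insert i (A - {a}) \<in> ?F" using that AS fA card_Suc_Diff1[OF fA, of a] by auto
    from A(2)[OF this] show ?thesis using that fA by (simp add: sum_diff1)
  qed
  have low: "- (M / k) \<le> x i" if "i \<in> {1..n} - A" for i
  proof -
    have "- M \<le> (\<Sum>a\<in>A. x a)" using M AS by blast
    also have "\<dots> \<le> (\<Sum>a\<in>A. x i)" by (intro sum_mono out that)
    finally show ?thesis using AS k by (simp add: field_simps)
  qed
  define Q where "Q = {i \<in> {1..n} - A. x i \<le> 0}"
  define P where "P = {i \<in> {1..n} - A. x i > 0}"
  have fPQ: "finite P" "finite Q" unfolding P_def Q_def by auto
  have dec: "{1..n} = A \<union> (P \<union> Q)" "A \<inter> (P \<union> Q) = {}" "P \<inter> Q = {}"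
    using AS unfolding P_def Q_def by auto
  have n: "n = k + (card P + card Q)"
    using arg_cong[OF dec(1), of card] dec(2,3) fA fPQ AS by (simp add: card_Un_disjoint)
  have sums: "(\<Sum>i\<in>A. x i) + ((\<Sum>i\<in>P. x i) + (\<Sum>i\<in>Q. x i)) = 0"
    using sum0 dec fA fPQ unfolding dec(1) by (simp add: sum.union_disjoint)
  have fl: "(\<lambda>i. \<lfloor>- x i\<rfloor>) \<in> Q \<rightarrow> {0..\<lfloor>M / k\<rfloor>}"
    using low unfolding Q_def by (force simp: intro: floor_mono)
  \<comment> \<open>Entries of \<open>Q\<close> with equal floors differ by an integer and hence
    coincide, so a fibre lies in one level set of a nonpositive value.\<close>
  have fib: "card {i \<in> Q. \<lfloor>- x i\<rfloor> = z} \<le> k - 1" for z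
  proof (cases "\<exists>i. i \<in> Q \<and> \<lfloor>- x i\<rfloor> = z")
    case True
    then obtain i where i: "i \<in> Q" "\<lfloor>- x i\<rfloor> = z" by blast
    have "x l = x i" if l: "l \<in> Q" "\<lfloor>- x l\<rfloor> = z" for l
    proof -
      obtain m where m: "x l - x i = of_int m"
        using diff[of l i] l i unfolding Q_def by (auto elim: Ints_cases)
      have "- x i = - x l + of_int m" using m by simp
      then have "\<lfloor>- x i\<rfloor> = \<lfloor>- x l\<rfloor> + m" by (metis floor_add_int)
      then show ?thesis using i l m by simp
    qed
    then have "{i \<in> Q. \<lfloor>- x i\<rfloor> = z} \<subseteq> {l \<in> {1..n}. x l = x i}" unfolding Q_def by auto
    then have "card {i \<in> Q. \<lfloor>- x i\<rfloor> = z} \<le> card {l \<in> {1..n}. x l = x i}"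
      by (intro card_mono) auto
    also have "\<dots> < k" using i unfolding Q_def by (intro rare) auto
    finally show ?thesis by simp
  next
    case False
    then have e: "{i \<in> Q. \<lfloor>- x i\<rfloor> = z} = {}" by blast
    show ?thesis unfolding e by simp
  qed
  have Y: "0 \<le> M / k" using M(2) by simp
  have "card Q = (\<Sum>z\<in>{0..\<lfloor>M / k\<rfloor>}. card {i \<in> Q. \<lfloor>- x i\<rfloor> = z})"
    unfolding card_eq_sum using fl by (intro sum.group[symmetric] fPQ) auto
  also have "\<dots> \<le> (\<Sum>z\<in>{0..\<lfloor>M / k\<rfloor>}. k - 1)" by (intro sum_mono fib)
  finally have "real (card Q) \<le> real (nat (\<lfloor>M / k\<rfloor> + 1) * (k - 1))" by (simp del: of_nat_mult)
  also have "\<dots> = (of_int \<lfloor>M / k\<rfloor> + 1) * (real k - 1)" using Y k by (simp add: of_nat_diff)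
  also have "\<dots> \<le> (M / k + 1) * (real k - 1)" using k by (intro mult_right_mono) auto
  finally have cQ: "real (card Q) \<le> (real k - 1) * (M / k + 1)" by (simp add: mult.commute)
  have "(\<Sum>i\<in>Q. - (M / k)) \<le> (\<Sum>i\<in>Q. x i)"
    using low unfolding Q_def by (intro sum_mono) auto
  then have sQ: "- (M / k * card Q) \<le> (\<Sum>i\<in>Q. x i)" by (simp add: mult.commute)
  have "1 / k \<le> x i" if "i \<in> P" for i
  proof -
    have "real k * x i \<in> \<int>" using that unfolding P_def by (intro kx) auto
    then obtain m where m: "real k * x i = of_int m" by (elim Ints_cases)
    moreover have "0 < real k * x i" using that k unfolding P_def by simp
    ultimately have "1 \<le> real k * x i" by simp
    then show ?thesis using k by (simp add: field_simps)
  qed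
  then have "(\<Sum>i\<in>P. 1 / k) \<le> (\<Sum>i\<in>P. x i)" by (intro sum_mono)
  then have sP: "card P / k \<le> (\<Sum>i\<in>P. x i)" by simp
  have "- M \<le> (\<Sum>i\<in>A. x i)" using M AS by blast
  \<comment> \<open>Since the total is zero, the entries on \<open>P\<close> are balanced by at most
    \<open>M\<close> from \<open>A\<close> and at most \<open>M / k\<close> from each element of
    \<open>Q\<close>.\<close>
  then have "card P / k \<le> M + M / k * card Q" using sP sQ sums by linarith
  then have "card P \<le> k * M + M * card Q" using k by (simp add: field_simps)
  then have "real n \<le> k + k * M + (M + 1) * card Q" using n by (simp add: algebra_simps)
  also have "\<dots> \<le> k + k * M + (M + 1) * ((real k - 1) * (M / k + 1))"
    using cQ M(2) by (intro add_left_mono mult_left_mono) auto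
  finally show ?thesis .
qed

text \<open>The left side increases with \<open>M\<close>, so \<open>M\<close> may be raised to h =
  j/2. With w = h/k the gap to \<open>T k\<close> is a sum of nonnegative terms, among them k + 1 >
  0.\<close>

lemma entry_bound_le_T:
  fixes M :: real
  assumes k: "1 \<le> k" and M: "0 \<le> M" "2 * M \<le> jpar k"
  shows "k + k * M + (M + 1) * ((real k - 1) * (M / k + 1)) < T k"
proof -
  define h where "h = real (jpar k) / 2"
  have h: "real (jpar k) = 2 * h" "M \<le> h" "0 \<le> h" using M unfolding h_def by auto
  have "k + k * M + (M + 1) * ((real k - 1) * (M / k + 1))
     \<le> k + k * h + (h + 1) * ((real k - 1) * (h / k + 1))"
    using h k M by (intro add_mono mult_mono order_refl divide_right_mono) auto
  also have "\<dots> < (2 * h)\<^sup>2 + 2 * k * (2 * h) + 3 * k - 2 * h - (2 * h)\<^sup>2 / k"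
  proof -
    define w where "w = h / real k"
    have w: "h = real k * w" "0 \<le> w" using k h(3) unfolding w_def by auto
    have d: "h / k = w" "(2 * h)\<^sup>2 / k = 4 * real k * w\<^sup>2"
      using k unfolding w(1) by (auto simp: power2_eq_square)
    have "((2 * h)\<^sup>2 + 2 * k * (2 * h) + 3 * k - 2 * h - 4 * real k * w\<^sup>2)
      - (k + k * h + (h + 1) * ((real k - 1) * (w + 1)))
      = 3 * (k * (real k - 1) * w\<^sup>2) + 2 * (k * (real k - 1) * w) + w + (real k + 1)"
      unfolding w(1) by (simp add: algebra_simps power2_eq_square)
    moreover have "0 \<le> k * (real k - 1) * w\<^sup>2" "0 \<le> k * (real k - 1) * w" using w k by auto
    ultimately show ?thesis unfolding d using w(2) by linarith
  qed
  also have "\<dots> = T k" unfolding T_def h(1) Let_def by simp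
  finally show ?thesis .
qed

section \<open>The parameters\<close>

lemma N_le:
  assumes "(a, b, r, s) \<in> B n k"
  shows "N n k \<le> max (real k * (real a + real r / real s)) (real k * (real b - real r / real s))"
  unfolding N_def
proof (rule cInf_lower)
  show "bdd_below {max (real k * (real a + real r / real s)) (real k * (real b - real r / real s))
                | a b r s. (a, b, r, s) \<in> B n k}"
    by (rule bdd_belowI[of _ 0]) (auto simp: le_max_iff_disj)
qed (use assms in blast)

lemma gamma_props:
  assumes "1 \<le> k"
  shows "0 < gamma k" "\<not> gamma k dvd k" "\<And>g. 0 < g \<Longrightarrow> g < gamma k \<Longrightarrow> g dvd k"
proof -
  have "0 < Suc k \<and> \<not> Suc k dvd k" using assms by (auto dest: dvd_imp_le)
  from LeastI[where P = "\<lambda>g. 0 < g \<and> \<not> g dvd k", OF this]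
  show "0 < gamma k" "\<not> gamma k dvd k" unfolding gamma_def by auto
  show "g dvd k" if "0 < g" "g < gamma k" for g
    using not_less_Least[of g "\<lambda>g. 0 < g \<and> \<not> g dvd k"] that unfolding gamma_def by auto
qed

text \<open>Let g = \<open>gamma k\<close> and b = g div 2 + 1. If g is odd, then 2bk = gk + k. If g
  = 2c with c > 1, then 2 and c are below g and divide k, but 2c does not; so c is even, k = cq with
  q odd, and bk = c(c + 1)q with (c + 1)q odd. For g = 2 one has b = g.\<close>

lemma gamma_not_dvd:
  assumes "1 \<le> k"
  shows "\<not> gamma k dvd (gamma k div 2 + 1) * k \<or> gamma k = 2"
proof (cases "odd (gamma k)")
  case True
  then obtain c where c: "gamma k = 2 * c + 1" by (elim oddE)
  have "2 * ((gamma k div 2 + 1) * k) = gamma k * k + k" unfolding c by (simp add: algebra_simps)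
  moreover have "\<not> gamma k dvd gamma k * k + k"
    using gamma_props(2)[OF assms] by (simp only: dvd_add_right_iff[OF dvd_triv_left] not_False_eq_True)
  ultimately show ?thesis by (metis dvd_mult)
next
  case False
  then obtain c where c: "gamma k = 2 * c" by auto
  show ?thesis
  proof (cases "c = 1")
    case False
    then have "0 < c" "c < gamma k" "2 < gamma k" using c gamma_props(1)[OF assms] by auto
    then have dv: "c dvd k" "2 dvd k" using gamma_props(3)[OF assms] by auto
    have "even c"
    proof (rule ccontr)
      assume "odd c"
      then have "coprime 2 c" by simp
      from divides_mult[OF dv(2,1) this] show False using gamma_props(2)[OF assms] c by simp
    qed
    obtain q where q: "k = c * q" using dv by blast
    have "odd q" using q c gamma_props(2)[OF assms] by auto
    have "(gamma k div 2 + 1) * k = c * ((c + 1) * q)" using c q by simp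
    then have "gamma k dvd (gamma k div 2 + 1) * k \<longleftrightarrow> 2 dvd (c + 1) * q"
      using c \<open>0 < c\<close> by (simp add: mult.commute[of 2])
    then show ?thesis using \<open>even c\<close> \<open>odd q\<close> by simp
  qed (use c in auto)
qed

text \<open>Quadruples with r = 0 and s = 1 suffice: a = b = 1 for odd \<open>k\<close>, and a + b =
  \<open>gamma k\<close> with \<open>b\<close> just above half of it for even \<open>k\<close>. They
  belong to \<open>B n k\<close> when a + b does not divide bk.\<close>

lemma N_le_jpar:
  assumes k: "1 \<le> k"
  shows "2 * N n k \<le> jpar k"
proof -
  have *: "N n k \<le> real k * max (real a) (real b)"
    if b: "b \<noteq> 0" "\<not> (a + b) dvd b * k" for a b
  proof -
    have "(real b * real 1 - real 0) * real k / (real 1 * (real a + real b)) \<notin> \<int>"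
    proof
      assume "(real b * real 1 - real 0) * real k / (real 1 * (real a + real b)) \<in> \<int>"
      then have "real (b * k) / real (a + b) \<in> \<int>" by simp
      then obtain m where m: "real (b * k) / real (a + b) = of_int m" by (auto elim: Ints_cases)
      then have "real_of_int (int (b * k)) = of_int (m * int (a + b))" using b by (simp add: field_simps)
      then have "int (b * k) = m * int (a + b)" by (simp only: of_int_eq_iff)
      then have "int (a + b) dvd int (b * k)" by simp
      then show False using b by (simp only: of_nat_dvd_iff)
    qed
    then have "(a, b, 0, 1) \<in> B n k" using b unfolding B_def by simp
    from N_le[OF this] show ?thesis using k by (simp add: max_mult_distrib_left)
  qed
  show ?thesis
  proof (cases "odd k")
    case True
    then show ?thesis using *[of 1 1] by (simp add: jpar_def numeral_2_eq_2[symmetric])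
  next
    case False
    then have g: "gamma k \<noteq> 2" "gamma k \<noteq> 1" "gamma k \<noteq> 0" using gamma_props[OF k] by auto
    let ?b = "gamma k div 2 + 1"
    have b: "?b \<le> gamma k" "gamma k - ?b \<le> ?b" using g by auto
    have "N n k \<le> real k * max (real (gamma k - ?b)) (real ?b)"
      using gamma_not_dvd[OF k] g b by (intro *) auto
    also have "max (real (gamma k - ?b)) (real ?b) = real ?b" using b by linarith
    finally have "2 * N n k \<le> real (?b * (2 * k))" by (simp add: algebra_simps)
    also have "\<dots> \<le> real (jpar k)"
      using False unfolding jpar_def of_nat_le_iff by (simp only: if_False mult_le_mono2)
    finally show ?thesis .
  qed
qed

text \<open>\<open>k\<close> times the fractional part is an integer c with 0 <= c < k; reducing c/k
  gives r/s with s dividing \<open>k\<close>. Integrality of nr/s and coprimality then give that s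
  divides \<open>n\<close>.\<close>

lemma fractional_part_lowest_terms:
  fixes p :: real
  assumes k: "1 \<le> k" and p: "real k * p \<in> \<int>" "real n * p \<in> \<int>"
  shows "\<exists>r s. r < s \<and> coprime s r \<and> s dvd gcd n k \<and> p - of_int \<lfloor>p\<rfloor> = real r / real s"
proof -
  have "real k * frac p \<in> \<int>" "real n * frac p \<in> \<int>"
    using p by (auto simp: frac_def right_diff_distrib)
  then obtain c e where ce: "real k * frac p = of_int c" "real n * frac p = of_int e" by (auto elim!: Ints_cases)
  have "0 \<le> real_of_int c" unfolding ce(1)[symmetric] by simp
  moreover have "real_of_int c < real k"
    unfolding ce(1)[symmetric] using k frac_lt_1[of p] by simp
  ultimately obtain c' where c: "c = int c'" "c' < k"
    by (metis nonneg_int_cases of_int_0_le_iff of_int_of_nat_eq of_nat_less_iff)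
  let ?d = "gcd c' k"
  define r s where "r = c' div ?d" and "s = k div ?d"
  have d0: "0 < ?d" using k by simp
  have rs: "c' = r * ?d" "k = s * ?d" unfolding r_def s_def by auto
  have cop: "coprime s r" unfolding r_def s_def using k
    by (metis coprime_commute div_gcd_coprime not_one_le_zero)
  have s0: "0 < s" using rs k by (metis gr0I mult_zero_left not_one_le_zero)
  have fr: "frac p = real r / real s"
  proof -
    have "frac p = real c' / real k" using ce c k by (simp add: field_simps)
    also have "\<dots> = real r / real s" using d0 arg_cong[OF rs(1), of real] arg_cong[OF rs(2), of real] s0
      by (simp add: field_simps)
    finally show ?thesis .
  qed
  have "r < s" using c(2) rs by (metis mult_less_cancel2)
  moreover have "s dvd k" using rs by (metis dvd_triv_left)
  moreover have "s dvd n"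
  proof -
    have "real_of_int (int n * int r) = of_int (e * int s)" using ce(2) s0 unfolding fr by (simp add: field_simps)
    then have "int n * int r = e * int s" by (simp only: of_int_eq_iff)
    then have "int s dvd int n * int r" by simp
    then have "s dvd n * r" by (simp only: of_nat_dvd_iff flip: of_nat_mult)
    then show ?thesis using cop by (simp add: coprime_dvd_mult_left_iff)
  qed
  ultimately show ?thesis using cop fr unfolding frac_def by auto
qed

section \<open>From frequent entries to the norm bound\<close>

text \<open>Sets with \<open>t\<close> entries \<open>p\<close> and k - t entries \<open>q\<close>
  have sum tp + (k - t)q. That no such sum vanishes is the non-integrality condition in
  \<open>B n k\<close> for p = a + r/s and q = r/s - b.\<close>

lemma N_le_of_frequent_entries:
  fixes x :: "nat \<Rightarrow> real"
  assumes k: "1 \<le> k"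
    and pq: "0 < p" "q < 0" "p - q \<in> \<int>" "real k * p \<in> \<int>" "real n * p \<in> \<int>"
    and fp: "k \<le> card {i \<in> {1..n}. x i = p}" and fq: "k \<le> card {i \<in> {1..n}. x i = q}"
    and nz: "\<And>S. S \<subseteq> {1..n} \<Longrightarrow> card S = k \<Longrightarrow> (\<Sum>i\<in>S. x i) \<noteq> 0"
    and M: "\<And>S. S \<subseteq> {1..n} \<Longrightarrow> card S = k \<Longrightarrow> \<bar>\<Sum>i\<in>S. x i\<bar> \<le> M"
  shows "N n k \<le> M"
proof -
  have mix: "\<exists>S. S \<subseteq> {1..n} \<and> card S = k \<and> (\<Sum>i\<in>S. x i) = real t * p + real (k - t) * q"
    if t: "t \<le> k" for t
  proof -
    obtain U where U: "U \<subseteq> {i \<in> {1..n}. x i = p}" "card U = t" "finite U"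
      using obtain_subset_with_card_n[OF le_trans[OF t fp]] by blast
    obtain W where W: "W \<subseteq> {i \<in> {1..n}. x i = q}" "card W = k - t" "finite W"
      using obtain_subset_with_card_n[OF le_trans[OF diff_le_self fq]] by blast
    have disj: "U \<inter> W = {}" using U W pq by force
    have "(\<Sum>i\<in>U. x i) = (\<Sum>i\<in>U. p)" "(\<Sum>i\<in>W. x i) = (\<Sum>i\<in>W. q)"
      using U(1) W(1) by (auto intro!: sum.cong simp del: sum_constant)
    then have "(\<Sum>i\<in>U \<union> W. x i) = real t * p + real (k - t) * q"
      using U W disj by (simp add: sum.union_disjoint)
    moreover have "card (U \<union> W) = k" using U W disj t by (simp add: card_Un_disjoint)
    ultimately show ?thesis using U W by (intro exI[of _ "U \<union> W"]) auto
  qed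
  have "\<bar>real t * p + real (k - t) * q\<bar> \<le> M" if "t \<le> k" for t
    using mix[OF that] M by metis
  \<comment> \<open>The pure sets bound both terms of the maximum in \<open>N\<close>.\<close>
  from this[of k] this[of 0] have kp: "real k * p \<le> M" and kq: "real k * - q \<le> M" by auto
  obtain r s where rs: "r < s" "coprime s r" "s dvd gcd n k" "p - of_int \<lfloor>p\<rfloor> = real r / real s"
    using fractional_part_lowest_terms[OF k pq(4,5)] by blast
  define a where "a = nat \<lfloor>p\<rfloor>"
  have pa: "p = real a + real r / real s" using rs(4) pq(1) by (simp add: a_def)
  obtain D where D: "p - q = of_int D" using pq(3) by (auto elim: Ints_cases)
  have "0 \<le> real r / real s" by simp
  then have "real a < p - q" using pq(2) pa by linarith
  then have "real_of_int (int a) < of_int D" using D by simp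
  then have aD: "int a < D" by (simp only: of_int_less_iff)
  define b where "b = nat (D - int a)"
  have b: "b \<noteq> 0" "D = int a + int b" using aD by (auto simp: b_def)
  have qb: "q = real r / real s - real b" using pa D b by simp
  have ab: "p - q = real a + real b" using D b by simp
  have "(real b * real s - real r) * real k / (real s * (real a + real b)) = - q * real k / (p - q)"
  proof -
    have "real b * real s - real r = real s * - q" unfolding qb using rs(1) by (simp add: field_simps)
    then show ?thesis using rs(1) unfolding ab[symmetric] by (simp only: mult.assoc) simp
  qed
  moreover have "- q * real k / (p - q) \<notin> \<int>"
  proof
    assume "- q * real k / (p - q) \<in> \<int>"
    then obtain t where t: "- q * real k / (p - q) = of_int t" by (rule Ints_cases)
    have "0 \<le> - q * real k / (p - q)" using pq by (intro divide_nonneg_nonneg mult_nonneg_nonneg) auto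
    then have "0 \<le> t" unfolding t by simp
    then obtain t' where t': "t = int t'" using nonneg_int_cases by blast
    have e: "- q * real k = real t' * (p - q)" using t t' pq by (simp add: field_simps)
    \<comment> \<open>As p > 0, the integer \<open>t'\<close> is at most \<open>k\<close>, so it is
      an admissible number of entries \<open>p\<close>, and the mixed set would have sum 0.\<close>
    have "real t' * (p - q) \<le> real k * (p - q)"
      unfolding e[symmetric] using pq(1) by (simp add: algebra_simps)
    then have "t' \<le> k" using pq by simp
    moreover from this have "real t' * p + real (k - t') * q = 0"
      using e by (simp add: of_nat_diff algebra_simps)
    ultimately show False using mix[of t'] nz by metis
  qed
  ultimately have "(a, b, r, s) \<in> B n k" unfolding B_def using b rs by auto
  from N_le[OF this] have "N n k \<le> max (real k * p) (real k * - q)" unfolding pa qb by simp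
  then show ?thesis using kp kq by linarith
qed

text \<open>If M < \<open>N n k\<close>, then 2M <= \<open>jpar k\<close>, and n >
  \<open>T k\<close> contradicts the counting bound for \<open>x\<close> and for \<open>- x\<close>.
  So a value <= 0 and a value >= 0 each occur at least \<open>k\<close> times.\<close>

lemma N_le_norm_of_sum_vector:
  fixes x :: "nat \<Rightarrow> real"
  assumes k: "1 \<le> k" "k < n" and n: "real n > T k"
    and sum0: "(\<Sum>i=1..n. x i) = 0"
    and int: "\<And>S. S \<subseteq> {1..n} \<Longrightarrow> card S = k \<Longrightarrow> (\<Sum>i\<in>S. x i) \<in> \<int>"
    and nz: "\<And>S. S \<subseteq> {1..n} \<Longrightarrow> card S = k \<Longrightarrow> (\<Sum>i\<in>S. x i) \<noteq> 0"
    and M: "\<And>S. S \<subseteq> {1..n} \<Longrightarrow> card S = k \<Longrightarrow> \<bar>\<Sum>i\<in>S. x i\<bar> \<le> M"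
  shows "N n k \<le> M"
proof (rule ccontr)
  assume "\<not> N n k \<le> M"
  then have jM: "2 * M \<le> jpar k" using N_le_jpar[OF k(1), of n] by simp
  have k1: "{1..k} \<subseteq> {1..n}" "card {1..k} = k" using k by auto
  have M0: "0 \<le> M" using M[OF k1] by simp
  have diff: "x i - x j \<in> \<int>" if ij: "i \<in> {1..n}" "j \<in> {1..n}" for i j
  proof (cases "i = j")
    case False
    \<comment> \<open>As k < n, there is room for k - 1 further elements; completing them by
      \<open>i\<close> or by \<open>j\<close> gives sums that differ by x i - x j.\<close>
    have "card ({1..n} - {i, j}) = n - 2" using ij False by (simp add: card_Diff_subset)
    then have "k - 1 \<le> card ({1..n} - {i, j})" using k by simp
    then obtain R where R: "R \<subseteq> {1..n} - {i, j}" "card R = k - 1" "finite R"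
      using obtain_subset_with_card_n by blast
    have nin: "i \<notin> R" "j \<notin> R" using R by auto
    then have c: "card (insert i R) = k" "card (insert j R) = k" using R k by auto
    have "(\<Sum>l\<in>insert i R. x l) - (\<Sum>l\<in>insert j R. x l) \<in> \<int>"
      using R ij c by (intro Ints_diff int) auto
    then show ?thesis using nin R by simp
  qed simp
  have kx: "real k * x i \<in> \<int>" if i: "i \<in> {1..n}" for i
  proof -
    have "(\<Sum>j\<in>{1..k}. x j) + (\<Sum>j\<in>{1..k}. x i - x j) \<in> \<int>"
      using k1 k i by (intro Ints_add int Ints_sum diff) auto
    then show ?thesis by (simp add: sum_subtractf)
  qed
  have nx: "real n * x i \<in> \<int>" if i: "i \<in> {1..n}" for i
  proof -
    have "(\<Sum>j\<in>{1..n}. x i - x j) \<in> \<int>" by (intro Ints_sum diff i)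
    then show ?thesis using sum0 by (simp add: sum_subtractf)
  qed
  have big: "\<not> real n \<le> k + k * M + (M + 1) * ((real k - 1) * (M / k + 1))"
    using entry_bound_le_T[OF k(1) M0 jM] n by simp
  \<comment> \<open>A \<open>k\<close>-set of zero entries would have sum 0.\<close>
  have nz': "c \<noteq> 0" if "k \<le> card {i \<in> {1..n}. x i = c}" for c
  proof
    assume c: "c = 0"
    obtain S where S: "S \<subseteq> {i \<in> {1..n}. x i = c}" "card S = k"
      using obtain_subset_with_card_n[OF \<open>k \<le> card {i \<in> {1..n}. x i = c}\<close>] by blast
    then have "(\<Sum>i\<in>S. x i) = 0" using c by (intro sum.neutral) auto
    moreover have "S \<subseteq> {1..n}" using S(1) by blast
    ultimately show False using S(2) nz by blast
  qed
  obtain q where q: "q \<le> 0" "k \<le> card {i \<in> {1..n}. x i = q}"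
  proof (rule ccontr)
    assume "\<not> thesis"
    then have "\<And>c. c \<le> 0 \<Longrightarrow> card {i \<in> {1..n}. x i = c} < k" using that not_less by blast
    then have "real n \<le> k + k * M + (M + 1) * ((real k - 1) * (M / k + 1))"
      using k M M0 sum0 diff kx
      by (intro few_entries_if_nonpos_rare[where x = x]) (auto simp: abs_le_iff minus_le_iff)
    then show False using big by simp
  qed
  obtain p where p: "0 \<le> p" "k \<le> card {i \<in> {1..n}. x i = p}"
  proof (rule ccontr)
    assume "\<not> thesis"
    then have rare: "\<And>c. 0 \<le> c \<Longrightarrow> card {i \<in> {1..n}. x i = c} < k" using that not_less by blast
    have rare': "card {i \<in> {1..n}. - x i = c} < k" if "c \<le> 0" for c
    proof -
      have "{i \<in> {1..n}. - x i = c} = {i \<in> {1..n}. x i = - c}" by auto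
      then show ?thesis using rare[of "- c"] that by simp
    qed
    have "real n \<le> k + k * M + (M + 1) * ((real k - 1) * (M / k + 1))"
    proof (rule few_entries_if_nonpos_rare[where x = "\<lambda>i. - x i"])
      show "- x i - - x j \<in> \<int>" if "i \<in> {1..n}" "j \<in> {1..n}" for i j
        using diff[OF that(2,1)] by simp
      show "- M \<le> (\<Sum>i\<in>S. - x i)" if "S \<subseteq> {1..n}" "card S = k" for S
        using M[OF that] by (simp add: sum_negf)
    qed (use k sum0 kx M0 rare' in \<open>auto simp: sum_negf\<close>)
    then show False using big by simp
  qed
  have "p \<noteq> 0" "q \<noteq> 0" using nz' p q by auto
  have "{i \<in> {1..n}. x i = p} \<noteq> {}" "{i \<in> {1..n}. x i = q} \<noteq> {}"
    using p q k by (metis card.empty not_one_le_zero le_zero_eq)+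
  then have "p - q \<in> \<int>" "real k * p \<in> \<int>" "real n * p \<in> \<int>" using diff kx nx by auto
  then have "N n k \<le> M"
    using p q \<open>p \<noteq> 0\<close> \<open>q \<noteq> 0\<close> nz M k
    by (intro N_le_of_frequent_entries[where x = x and p = p and q = q]) auto
  then show False using \<open>\<not> N n k \<le> M\<close> by simp
qed

theorem theorem4:
  fixes n k :: nat
  assumes "1 \<le> k" and "k < n" and "real n > T k"
  shows "m1 (johnson n k) \<ge> N n k + 1"
  unfolding m1_def
proof (rule cInf_greatest)
  note th = theta1_johnson[OF assms(1,2)]
  show "{inf_norm (johnson n k) v + 1 |v.
      graph_eigenvector (johnson n k) (theta1 (johnson n k)) v \<and> NZI (johnson n k) v} \<noteq> {}"
    using spike_eigenvector[OF assms(1,2)] unfolding th by blast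
  fix y assume "y \<in> {inf_norm (johnson n k) v + 1 |v.
      graph_eigenvector (johnson n k) (theta1 (johnson n k)) v \<and> NZI (johnson n k) v}"
  then obtain v where v: "y = inf_norm (johnson n k) v + 1"
    "graph_eigenvector (johnson n k) (real k * (real n - real k) - real n) v" "NZI (johnson n k) v"
    unfolding th by blast
  \<comment> \<open>\<open>v\<close> agrees with the sums only on vertices, which is all that
    \<open>NZI\<close> and \<open>inf_norm\<close> see.\<close>
  obtain x where x: "(\<Sum>i=1..n. x i) = 0"
    "\<And>S. S \<subseteq> {1..n} \<Longrightarrow> card S = k \<Longrightarrow> v S = (\<Sum>i\<in>S. x i)"
    using second_eigenvector_form[OF assms(1,2), of v] v(2) unfolding graph_eigenvector_johnson by blast
  have "N n k \<le> inf_norm (johnson n k) v"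
  proof (rule N_le_norm_of_sum_vector[OF assms x(1)])
    fix S assume S: "S \<subseteq> {1..n}" "card S = k"
    then have SV: "S \<in> pverts (johnson n k)" by (simp add: johnson_verts)
    show "(\<Sum>i\<in>S. x i) \<in> \<int>" "(\<Sum>i\<in>S. x i) \<noteq> 0"
      using v(3) SV unfolding NZI_def x(2)[OF S, symmetric] by auto
    show "\<bar>\<Sum>i\<in>S. x i\<bar> \<le> inf_norm (johnson n k) v"
      unfolding inf_norm_def x(2)[OF S, symmetric] using SV finite_johnson_verts by auto
  qed
  then show "N n k + 1 \<le> y" using v(1) by simp
qed

end
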